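(* Every real-valued Lévy process $(X_t;\ t\geq 0)$ is an IDT process.
   Context: A real-valued stochastic process $(X_t;\ t\geq 0)$ is called an IDT process (infinitely divisible with respect to time) if for every integer $n\geq 1$, $(X_{nt};\ t\geq 0)\overset{(d)}{=}(X^{(1)}_t+\dots+X^{(n)}_t;\ t\geq 0)$, where $X^{(1)},\dots,X^{(n)}$ are independent copies of $X$ and $\overset{(d)}{=}$ denotes equality in law of processes, i.e. equality of all finite-dimensional distributions. *)

theory Defs
  imports "HOL-Probability.Probability"
begin

text \<open>
  A real-valued process with time set \<open>{0..}\<close> is represented by a total function
  \<open>X :: real \<Rightarrow> 'a \<Rightarrow> real\<close>; its values at negative times are irrelevant.
\<close>

definition real_process :: "'a measure \<Rightarrow> (real \<Rightarrow> 'a \<Rightarrow> real) \<Rightarrow> bool" where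
  "real_process M X \<longleftrightarrow> prob_space M \<and> (\<forall>t\<ge>0. X t \<in> borel_measurable M)"

text \<open>Equality in law of processes: equality of all finite-dimensional distributions.\<close>

definition eq_law ::
  "'a measure \<Rightarrow> (real \<Rightarrow> 'a \<Rightarrow> real) \<Rightarrow> 'b measure \<Rightarrow> (real \<Rightarrow> 'b \<Rightarrow> real) \<Rightarrow> bool" where
  "eq_law M X N Y \<longleftrightarrow>
     (\<forall>J. finite J \<and> J \<subseteq> {0..} \<longrightarrow>
        distr M (Pi\<^sub>M J (\<lambda>_. borel)) (\<lambda>\<omega>. \<lambda>t\<in>J. X t \<omega>) =
        distr N (Pi\<^sub>M J (\<lambda>_. borel)) (\<lambda>\<omega>. \<lambda>t\<in>J. Y t \<omega>))"

text \<open>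
  Independence of the copies is independence of the whole processes, viewed as random
  elements of the product space \<open>\<real>\<^bsup>{0..}\<^esup>\<close>.
\<close>

definition independent_copies ::
  "'a measure \<Rightarrow> (real \<Rightarrow> 'a \<Rightarrow> real) \<Rightarrow> nat \<Rightarrow>
   'b measure \<Rightarrow> (nat \<Rightarrow> real \<Rightarrow> 'b \<Rightarrow> real) \<Rightarrow> bool" where
  "independent_copies M X n N Y \<longleftrightarrow>
     (\<forall>i\<in>{1..n}. real_process N (Y i) \<and> eq_law N (Y i) M X) \<and>
     prob_space.indep_vars N (\<lambda>_. Pi\<^sub>M {0..} (\<lambda>_. borel)) (\<lambda>i \<omega>. \<lambda>t\<in>{0..}. Y i t \<omega>) {1..n}"

text \<open>
  The copies may live on any probability space. As HOL cannot quantify over types inside a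
  definition, the type of its sample points is an explicit parameter, to be left arbitrary. That
  copies exist on some type is the lemma below.
\<close>

definition IDT_process :: "'b itself \<Rightarrow> 'a measure \<Rightarrow> (real \<Rightarrow> 'a \<Rightarrow> real) \<Rightarrow> bool" where
  "IDT_process (_ :: 'b itself) M X \<longleftrightarrow>
     real_process M X \<and>
     (\<forall>n\<ge>1. \<forall>(N :: 'b measure) Y. independent_copies M X n N Y \<longrightarrow>
        eq_law M (\<lambda>t. X (real n * t)) N (\<lambda>t \<omega>. \<Sum>i=1..n. Y i t \<omega>))"

lemma independent_copies_exist:
  fixes M :: "'a measure"
  assumes "real_process M X" and "n \<ge> 1"
  shows "independent_copies M X n (Pi\<^sub>M {1..n} (\<lambda>_. M)) (\<lambda>i t \<omega>. X t (\<omega> i))"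
proof -
  interpret M: prob_space M using assms(1) by (simp add: real_process_def)
  have X: "X t \<in> borel_measurable M" if "t \<ge> 0" for t
    using assms(1) that by (simp add: real_process_def)
  let ?N = "Pi\<^sub>M {1..n} (\<lambda>_. M)"
  interpret N: prob_space ?N by (intro prob_space_PiM M.prob_space_axioms)
  have comp: "(\<lambda>\<omega>. \<omega> i) \<in> measurable ?N M" if "i \<in> {1..n}" for i
    using that by simp
  have coord: "distr ?N M (\<lambda>\<omega>. \<omega> i) = M" if "i \<in> {1..n}" for i
    using that by (intro distr_PiM_component M.prob_space_axioms) auto
  have "real_process ?N (\<lambda>t \<omega>. X t (\<omega> i))" if "i \<in> {1..n}" for i
    unfolding real_process_def
    using measurable_compose[OF comp[OF that] X] N.prob_space_axioms by auto
  moreover have "eq_law ?N (\<lambda>t \<omega>. X t (\<omega> i)) M X" if i: "i \<in> {1..n}" for i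
    unfolding eq_law_def
  proof (intro allI impI)
    fix J :: "real set" assume J: "finite J \<and> J \<subseteq> {0..}"
    have m: "(\<lambda>\<omega>. \<lambda>t\<in>J. X t \<omega>) \<in> measurable M (Pi\<^sub>M J (\<lambda>_. borel))"
      using J by (intro measurable_restrict X) auto
    show "distr ?N (Pi\<^sub>M J (\<lambda>_. borel)) (\<lambda>\<omega>. \<lambda>t\<in>J. X t (\<omega> i)) =
          distr M (Pi\<^sub>M J (\<lambda>_. borel)) (\<lambda>\<omega>. \<lambda>t\<in>J. X t \<omega>)"
      using distr_distr[OF m comp[OF i]] coord[OF i] by (simp add: comp_def)
  qed
  moreover have "N.indep_vars (\<lambda>_. M) (\<lambda>i \<omega>. \<omega> i) {1..n}"
  proof -
    have "distr ?N ?N (\<lambda>\<omega>. \<lambda>i\<in>{1..n}. \<omega> i) = ?N"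
      by (subst distr_id2[symmetric, of ?N ?N, OF refl], rule distr_cong)
         (auto simp: space_PiM PiE_def extensional_restrict)
    also have "?N = Pi\<^sub>M {1..n} (\<lambda>i. distr ?N M (\<lambda>\<omega>. \<omega> i))"
      by (rule PiM_cong) (simp_all only: coord)
    finally show ?thesis
      using assms(2) by (subst N.indep_vars_iff_distr_eq_PiM') (auto simp: comp)
  qed
  then have "N.indep_vars (\<lambda>_. Pi\<^sub>M {0..} (\<lambda>_. borel))
      (\<lambda>i \<omega>. (\<lambda>x. \<lambda>t\<in>{0..}. X t x) (\<omega> i)) {1..n}"
    by (rule N.indep_vars_compose2) (intro measurable_restrict X, simp)
  ultimately show ?thesis
    by (simp add: independent_copies_def)
qed

text \<open>
  Only stochastic continuity is required, not cadlag paths: for cadlag processes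
  it follows from stationarity of the increments.
\<close>

locale levy_process = prob_space M for M :: "'a measure" +
  fixes X :: "real \<Rightarrow> 'a \<Rightarrow> real"
  assumes measurable_X: "\<And>t. t \<ge> 0 \<Longrightarrow> random_variable borel (X t)"
    and start_zero: "AE \<omega> in M. X 0 \<omega> = 0"
    and indep_increments:
      "\<And>(\<tau> :: nat \<Rightarrow> real) m. \<tau> 0 \<ge> 0 \<Longrightarrow> (\<And>i. i < m \<Longrightarrow> \<tau> i < \<tau> (Suc i)) \<Longrightarrow>
         indep_vars (\<lambda>_. borel) (\<lambda>i \<omega>. X (\<tau> (Suc i)) \<omega> - X (\<tau> i) \<omega>) {..<m}"
    and stationary_increments:
      "\<And>s t. 0 \<le> s \<Longrightarrow> s \<le> t \<Longrightarrow>
         distr M borel (\<lambda>\<omega>. X t \<omega> - X s \<omega>) = distr M borel (X (t - s))"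
    and stochastic_continuity:
      "\<And>s e. s \<ge> 0 \<Longrightarrow> e > 0 \<Longrightarrow>
         ((\<lambda>t. prob {\<omega> \<in> space M. \<bar>X t \<omega> - X s \<omega>\<bar> > e}) \<longlongrightarrow> 0) (at s within {0..})"

end

theory Submission
  imports Defs
begin

text \<open>
  Fix a grid \<open>0 = \<tau>\<^sub>0 < \<dots> < \<tau>\<^sub>m\<close> and cut each interval of the dilated grid \<open>n \<tau>\<close> into \<open>n\<close> equal
  pieces. The increments of \<open>X\<close> over these pieces are independent, and those inside the
  \<open>k\<close>-th interval have the law of \<open>X (\<tau>\<^sub>k\<^sub>+\<^sub>1 - \<tau>\<^sub>k)\<close>. Hence they have the same joint law as the
  increments of the \<open>n\<close> copies along \<open>\<tau>\<close>, and both \<open>X (n \<tau>\<^sub>k)\<close> and the sum of the copies at \<open>\<tau>\<^sub>k\<close>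
  are, almost surely, the same partial sums of these families.
\<close>

section \<open>Independence and product laws\<close>

lemma (in prob_space) distr_indep_vars:
  assumes "indep_vars M' X I" "I \<noteq> {}"
  shows "distr M (Pi\<^sub>M I M') (\<lambda>x. \<lambda>i\<in>I. X i x) = Pi\<^sub>M I (\<lambda>i. distr M (M' i) (X i))"
  using assms by (intro indep_vars_iff_distr_eq_PiM'[THEN iffD1]) (auto simp: indep_vars_def)

text \<open>Independence is read as the joint law being a product measure. Reindexing a product of
  probability measures along an injection again gives a product, so the joint law of the reindexed
  family factorises as well. The empty family is split off because this characterisation is applied
  to nonempty index sets.\<close>

lemma (in prob_space) indep_vars_reindex_inj:
  assumes indep: "indep_vars M' X (f ` I)" and inj: "inj_on f I"
  shows "indep_vars (\<lambda>i. M' (f i)) (\<lambda>i. X (f i)) I"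
proof (cases "I = {}")
  case True
  then show ?thesis by (simp add: indep_vars_def indep_sets_def)
next
  case False
  let ?P = "\<lambda>i. distr M (M' i) (X i)"
  have rv: "random_variable (M' i) (X i)" if "i \<in> f ` I" for i
    using indep that by (auto simp: indep_vars_def)
  have joint: "distr M (Pi\<^sub>M (f ` I) M') (\<lambda>x. \<lambda>i\<in>f ` I. X i x) = Pi\<^sub>M (f ` I) ?P"
    using indep False by (intro distr_indep_vars) auto
  let ?r = "\<lambda>\<omega>. \<lambda>i\<in>I. \<omega> (f i)"
  have "Pi\<^sub>M I (\<lambda>i. ?P (f i)) = distr (Pi\<^sub>M (f ` I) ?P) (Pi\<^sub>M I (\<lambda>i. ?P (f i))) ?r"
    by (rule distr_PiM_reindex[symmetric]) (auto intro!: inj prob_space_distr rv)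
  also have "\<dots> = distr (distr M (Pi\<^sub>M (f ` I) M') (\<lambda>x. \<lambda>i\<in>f ` I. X i x)) (Pi\<^sub>M I (\<lambda>i. M' (f i))) ?r"
    by (rule distr_cong) (auto simp: joint cong: sets_PiM_cong)
  also have "\<dots> = distr M (Pi\<^sub>M I (\<lambda>i. M' (f i))) (?r \<circ> (\<lambda>x. \<lambda>i\<in>f ` I. X i x))"
    by (rule distr_distr)
      (auto intro!: measurable_restrict measurable_component_singleton rv)
  also have "?r \<circ> (\<lambda>x. \<lambda>i\<in>f ` I. X i x) = (\<lambda>x. \<lambda>i\<in>I. X (f i) x)"
    by (auto simp: fun_eq_iff restrict_def)
  finally have "distr M (Pi\<^sub>M I (\<lambda>i. M' (f i))) (\<lambda>x. \<lambda>i\<in>I. X (f i) x) = Pi\<^sub>M I (\<lambda>i. ?P (f i))"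
    by (rule sym)
  then show ?thesis
    by (intro indep_vars_iff_distr_eq_PiM'[THEN iffD2] False rv) simp_all
qed

section \<open>Increments along a grid\<close>

lemma grid_nonneg:
  fixes \<tau> :: "nat \<Rightarrow> real"
  assumes "\<tau> 0 \<ge> 0" and incr: "\<And>i. i < m \<Longrightarrow> \<tau> i < \<tau> (Suc i)" and "k \<le> m"
  shows "\<tau> k \<ge> 0"
  using \<open>k \<le> m\<close>
proof (induction k)
  case (Suc k)
  then show ?case using incr[of k] by simp
qed (use assms in simp)

text \<open>Independent increments make the joint law a product, and stationarity identifies each
  factor. Applied to a single copy, this gives its increment vector the law of a row of the nested
  array.\<close>

lemma (in levy_process) distr_increments:
  fixes \<tau> :: "nat \<Rightarrow> real"
  assumes "\<tau> 0 \<ge> 0" and incr: "\<And>i. i < m \<Longrightarrow> \<tau> i < \<tau> (Suc i)" and "m > 0"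
  shows "distr M (Pi\<^sub>M {..<m} (\<lambda>_. borel)) (\<lambda>\<omega>. \<lambda>k\<in>{..<m}. X (\<tau> (Suc k)) \<omega> - X (\<tau> k) \<omega>) =
    Pi\<^sub>M {..<m} (\<lambda>k. distr M borel (X (\<tau> (Suc k) - \<tau> k)))"
proof -
  have nonneg: "\<tau> k \<ge> 0" if "k \<le> m" for k
    using grid_nonneg[OF assms(1) incr that] .
  have "distr M (Pi\<^sub>M {..<m} (\<lambda>_. borel)) (\<lambda>\<omega>. \<lambda>k\<in>{..<m}. X (\<tau> (Suc k)) \<omega> - X (\<tau> k) \<omega>) =
      Pi\<^sub>M {..<m} (\<lambda>k. distr M borel (\<lambda>\<omega>. X (\<tau> (Suc k)) \<omega> - X (\<tau> k) \<omega>))"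
    using \<open>m > 0\<close> by (intro distr_indep_vars indep_increments assms) auto
  also have "\<dots> = Pi\<^sub>M {..<m} (\<lambda>k. distr M borel (X (\<tau> (Suc k) - \<tau> k)))"
    using nonneg incr by (intro PiM_cong refl stationary_increments) (auto simp: less_imp_le)
  finally show ?thesis .
qed

section \<open>Refinement of the dilated grid\<close>

lemma mult_add_less_mult:
  fixes j k m n :: nat
  assumes "k < m" "j < n"
  shows "k * n + j < m * n"
proof -
  have "k * n + j < Suc k * n" using assms by simp
  also have "\<dots> \<le> m * n" using assms by (intro mult_right_mono) auto
  finally show ?thesis .
qed

text \<open>Divides each interval \<open>[n \<tau>\<^sub>k, n \<tau>\<^sub>k\<^sub>+\<^sub>1]\<close> into \<open>n\<close> intervals of length \<open>\<tau>\<^sub>k\<^sub>+\<^sub>1 - \<tau>\<^sub>k\<close>.\<close>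

definition refined_grid :: "nat \<Rightarrow> (nat \<Rightarrow> real) \<Rightarrow> nat \<Rightarrow> real" where
  "refined_grid n \<tau> l = real n * \<tau> (l div n) + real (l mod n) * (\<tau> (Suc (l div n)) - \<tau> (l div n))"

lemma refined_grid_mult: "n > 0 \<Longrightarrow> refined_grid n \<tau> (k * n) = real n * \<tau> k"
  by (simp add: refined_grid_def)

text \<open>Inside a block only the remainder grows, by one. At the end of a block the remainder
  falls from \<open>n - 1\<close> to 0 while the quotient grows by one: with d the length of the
  interval of \<open>\<tau>\<close>, the change is \<open>n * d - (n - 1) * d\<close>, again a
  single d.\<close>

lemma refined_grid_diff:
  assumes "n > 0"
  shows "refined_grid n \<tau> (Suc l) - refined_grid n \<tau> l = \<tau> (Suc (l div n)) - \<tau> (l div n)"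
proof (cases "Suc (l mod n) = n")
  case True
  then have "Suc l mod n = 0" "Suc l div n = Suc (l div n)"
    using assms by (auto simp: mod_Suc div_Suc)
  moreover have "real n = real (l mod n) + 1"
    using True by linarith
  ultimately show ?thesis
    by (simp add: refined_grid_def algebra_simps)
next
  case False
  then have "Suc l mod n = Suc (l mod n)" "Suc l div n = l div n"
    using assms by (auto simp: mod_Suc div_Suc)
  then show ?thesis
    by (simp add: refined_grid_def algebra_simps)
qed

lemma refined_grid_less:
  assumes "\<And>i. i < m \<Longrightarrow> \<tau> i < \<tau> (Suc i)" "n > 0" "l < m * n"
  shows "refined_grid n \<tau> l < refined_grid n \<tau> (Suc l)"
  using refined_grid_diff[OF \<open>n > 0\<close>, of \<tau> l] assms(1)[of "l div n"] assms(3)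
  by (simp add: less_mult_imp_div_less)

lemma refined_grid_nonneg:
  assumes "\<tau> 0 \<ge> 0" "\<And>i. i < m \<Longrightarrow> \<tau> i < \<tau> (Suc i)" "n > 0" "l \<le> m * n"
  shows "refined_grid n \<tau> l \<ge> 0"
proof (rule grid_nonneg)
  show "refined_grid n \<tau> 0 \<ge> 0" using assms(1) by (simp add: refined_grid_def)
  show "refined_grid n \<tau> i < refined_grid n \<tau> (Suc i)" if "i < m * n" for i
    by (rule refined_grid_less[OF _ assms(3) that]) (rule assms(2))
qed fact

text \<open>Row \<open>i\<close> collects the \<open>i\<close>-th piece of every block, and thus
  imitates the increments of one copy along \<open>\<tau>\<close>. Rows use disjoint sets of fine
  increments, hence are independent; entries of a row are independent too, and stationarity gives
  their laws. Rows are numbered from 1 like the copies, whence the offset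
  \<open>i - 1\<close>.\<close>

lemma (in levy_process) distr_nested_increments:
  fixes \<tau> :: "nat \<Rightarrow> real"
  assumes "\<tau> 0 \<ge> 0" and incr: "\<And>i. i < m \<Longrightarrow> \<tau> i < \<tau> (Suc i)" and "m > 0" "n > 0"
  defines "\<xi> \<equiv> \<lambda>l \<omega>. X (refined_grid n \<tau> (Suc l)) \<omega> - X (refined_grid n \<tau> l) \<omega>"
  shows "distr M (Pi\<^sub>M {1..n} (\<lambda>_. Pi\<^sub>M {..<m} (\<lambda>_. borel))) (\<lambda>\<omega>. \<lambda>i\<in>{1..n}. \<lambda>k\<in>{..<m}. \<xi> (k * n + (i - 1)) \<omega>) =
    Pi\<^sub>M {1..n} (\<lambda>_. Pi\<^sub>M {..<m} (\<lambda>k. distr M borel (X (\<tau> (Suc k) - \<tau> k))))"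
proof -
  let ?\<sigma> = "refined_grid n \<tau>"
  have \<sigma>_incr: "?\<sigma> l < ?\<sigma> (Suc l)" if "l < m * n" for l
    by (rule refined_grid_less[OF _ \<open>n > 0\<close> that]) (rule incr)
  have nonneg: "?\<sigma> l \<ge> 0" if "l \<le> m * n" for l
    using refined_grid_nonneg[OF assms(1) incr \<open>n > 0\<close> that] .
  have indep: "indep_vars (\<lambda>_. borel) \<xi> {..<m * n}"
    unfolding \<xi>_def by (rule indep_increments[OF nonneg[OF le0] \<sigma>_incr])
  have index_less: "k * n + (i - 1) < m * n" if "k < m" "i \<in> {1..n}" for k i
    using that by (intro mult_add_less_mult) auto
  \<comment> \<open>For \<open>i\<close> in \<open>{1..n}\<close>, \<open>K i\<close> is the residue
    class of \<open>i - 1\<close> modulo \<open>n\<close> below \<open>m * n\<close>. An index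
    therefore determines its row, which gives disjointness.\<close>
  define K where "K i = (\<lambda>k. k * n + (i - 1)) ` {..<m}" for i
  have "indep_vars (\<lambda>i. Pi\<^sub>M (K i) (\<lambda>_. borel)) (\<lambda>i \<omega>. \<lambda>l\<in>K i. \<xi> l \<omega>) {1..n}"
  proof (rule indep_vars_restrict[OF indep])
    show "K i \<subseteq> {..<m * n}" if "i \<in> {1..n}" for i
      using index_less that by (auto simp: K_def)
    have K_mod: "i = Suc (l mod n)" if i: "i \<in> {1..n}" and l: "l \<in> K i" for i l
    proof -
      obtain k where "l = k * n + (i - 1)" using l by (auto simp only: K_def)
      then have "l mod n = (i - 1) mod n" by (simp only: mod_mult_self3)
      moreover have "i - 1 < n" using i by auto
      ultimately show ?thesis using i by simp
    qed
    show "disjoint_family_on K {1..n}"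
      unfolding disjoint_family_on_def
    proof (intro ballI impI)
      fix i j assume "i \<in> {1..n}" "j \<in> {1..n}" "i \<noteq> j"
      then show "K i \<inter> K j = {}" using K_mod[of i] K_mod[of j] by blast
    qed
  qed
  \<comment> \<open>Each row is relabelled from \<open>K i\<close> to the block numbers
    \<open>{..<m}\<close>, so that all rows take values in the same space.\<close>
  then have "indep_vars (\<lambda>_. Pi\<^sub>M {..<m} (\<lambda>_. borel))
      (\<lambda>i \<omega>. (\<lambda>v. \<lambda>k\<in>{..<m}. v (k * n + (i - 1))) (\<lambda>l\<in>K i. \<xi> l \<omega>)) {1..n}"
    by (rule indep_vars_compose2)
      (intro measurable_restrict measurable_component_singleton, simp add: K_def)
  then have "indep_vars (\<lambda>_. Pi\<^sub>M {..<m} (\<lambda>_. borel)) (\<lambda>i \<omega>. \<lambda>k\<in>{..<m}. \<xi> (k * n + (i - 1)) \<omega>) {1..n}"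
    by (rule indep_vars_cong[THEN iffD1, rotated -1]) (auto simp: K_def fun_eq_iff restrict_def)
  then have "distr M (Pi\<^sub>M {1..n} (\<lambda>_. Pi\<^sub>M {..<m} (\<lambda>_. borel))) (\<lambda>\<omega>. \<lambda>i\<in>{1..n}. \<lambda>k\<in>{..<m}. \<xi> (k * n + (i - 1)) \<omega>) =
      Pi\<^sub>M {1..n} (\<lambda>i. distr M (Pi\<^sub>M {..<m} (\<lambda>_. borel)) (\<lambda>\<omega>. \<lambda>k\<in>{..<m}. \<xi> (k * n + (i - 1)) \<omega>))"
    using \<open>n > 0\<close> by (intro distr_indep_vars) auto
  also have "\<dots> = Pi\<^sub>M {1..n} (\<lambda>_. Pi\<^sub>M {..<m} (\<lambda>k. distr M borel (X (\<tau> (Suc k) - \<tau> k))))"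
  proof (intro PiM_cong refl)
    fix i assume i: "i \<in> {1..n}"
    have "indep_vars (\<lambda>_. borel) (\<lambda>k. \<xi> (k * n + (i - 1))) {..<m}"
    proof (rule indep_vars_reindex_inj[where f = "\<lambda>k. k * n + (i - 1)"])
      show "indep_vars (\<lambda>_. borel) \<xi> ((\<lambda>k. k * n + (i - 1)) ` {..<m})"
        using index_less i by (intro indep_vars_subset[OF indep]) auto
      show "inj_on (\<lambda>k. k * n + (i - 1)) {..<m}"
        using \<open>n > 0\<close> by (intro inj_onI) (simp only: add_right_cancel mult_cancel2, simp)
    qed
    then have "distr M (Pi\<^sub>M {..<m} (\<lambda>_. borel)) (\<lambda>\<omega>. \<lambda>k\<in>{..<m}. \<xi> (k * n + (i - 1)) \<omega>) =
        Pi\<^sub>M {..<m} (\<lambda>k. distr M borel (\<xi> (k * n + (i - 1))))"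
      using \<open>m > 0\<close> by (intro distr_indep_vars) auto
    also have "\<dots> = Pi\<^sub>M {..<m} (\<lambda>k. distr M borel (X (\<tau> (Suc k) - \<tau> k)))"
    proof (intro PiM_cong refl)
      fix k assume k: "k \<in> {..<m}"
      let ?l = "k * n + (i - 1)"
      have l: "?l < m * n" using index_less k i by auto
      have "?l div n = k" using i by (subst div_mult_self3) auto
      then have "?\<sigma> (Suc ?l) - ?\<sigma> ?l = \<tau> (Suc k) - \<tau> k"
        using refined_grid_diff[OF \<open>n > 0\<close>, of \<tau> ?l] by simp
      then show "distr M borel (\<xi> ?l) = distr M borel (X (\<tau> (Suc k) - \<tau> k))"
        unfolding \<xi>_def using stationary_increments[of "?\<sigma> ?l" "?\<sigma> (Suc ?l)"] nonneg[of ?l] \<sigma>_incr[OF l] l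
        by simp
    qed
    finally show "distr M (Pi\<^sub>M {..<m} (\<lambda>_. borel)) (\<lambda>\<omega>. \<lambda>k\<in>{..<m}. \<xi> (k * n + (i - 1)) \<omega>) =
        Pi\<^sub>M {..<m} (\<lambda>k. distr M borel (X (\<tau> (Suc k) - \<tau> k)))" .
  qed
  finally show ?thesis .
qed

section \<open>Laws of the copies\<close>

text \<open>The law of a measurable functional of finitely many coordinates is the image of a
  finite-dimensional distribution.\<close>

lemma eq_law_functional:
  assumes law: "eq_law N Y M X" and "real_process N Y" "real_process M X"
    and J: "finite J" "J \<subseteq> {0..}" and g: "g \<in> measurable (Pi\<^sub>M J (\<lambda>_. borel)) L"
  shows "distr N L (\<lambda>\<omega>. g (\<lambda>t\<in>J. Y t \<omega>)) = distr M L (\<lambda>\<omega>. g (\<lambda>t\<in>J. X t \<omega>))"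
proof -
  \<comment> \<open>Stated for an arbitrary sample type, since it is applied to both
    \<open>Y\<close> and \<open>X\<close>.\<close>
  have *: "distr K L (\<lambda>\<omega>. g (\<lambda>t\<in>J. Z t \<omega>)) =
      distr (distr K (Pi\<^sub>M J (\<lambda>_. borel)) (\<lambda>\<omega>. \<lambda>t\<in>J. Z t \<omega>)) L g"
    if "real_process K Z" for K :: "'z measure" and Z
    using that J by (subst distr_distr[OF g])
      (auto simp: comp_def real_process_def intro!: measurable_restrict)
  show ?thesis
    using law J by (simp add: *[OF assms(2)] *[OF assms(3)] eq_law_def)
qed

lemma (in levy_process) real_process_X: "real_process M X"
  by (simp add: real_process_def prob_space_axioms measurable_X)

text \<open>Vanishing almost surely at time 0 is a property of the one-dimensional law at that time,
  so every copy inherits it.\<close>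

lemma (in levy_process) copy_start_zero:
  assumes "eq_law N Y M X" "real_process N Y"
  shows "AE \<omega> in N. Y 0 \<omega> = 0"
proof -
  have Y: "Y 0 \<in> borel_measurable N" using assms(2) by (simp add: real_process_def)
  have law: "distr N borel (Y 0) = distr M borel (X 0)"
    using eq_law_functional[OF assms real_process_X, of "{0}" "\<lambda>v. v 0" borel] by simp
  have "AE x in distr N borel (Y 0). x = 0"
    unfolding law using start_zero by (subst AE_distr_iff) (auto simp: measurable_X)
  then show ?thesis
    by (subst (asm) AE_distr_iff) (auto simp: Y)
qed

text \<open>The increments along \<open>\<tau>\<close> are a measurable function of the path, so
  independence of the whole copies passes to their increment vectors. Each vector depends on
  finitely many times only, hence has the same law as for \<open>X\<close>. The resulting product is
  the one found for the nested increments.\<close>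

lemma (in levy_process) distr_copies_increments:
  fixes \<tau> :: "nat \<Rightarrow> real"
  assumes "\<tau> 0 \<ge> 0" and incr: "\<And>i. i < m \<Longrightarrow> \<tau> i < \<tau> (Suc i)" and "m > 0" "n > 0"
    and copies: "independent_copies M X n N Y" and "prob_space N"
  shows "distr N (Pi\<^sub>M {1..n} (\<lambda>_. Pi\<^sub>M {..<m} (\<lambda>_. borel)))
      (\<lambda>\<omega>. \<lambda>i\<in>{1..n}. \<lambda>k\<in>{..<m}. Y i (\<tau> (Suc k)) \<omega> - Y i (\<tau> k) \<omega>) =
    Pi\<^sub>M {1..n} (\<lambda>_. Pi\<^sub>M {..<m} (\<lambda>k. distr M borel (X (\<tau> (Suc k) - \<tau> k))))"
proof -
  interpret N: prob_space N by fact
  let ?J = "\<tau> ` {..m}"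
  have nonneg: "\<tau> k \<ge> 0" if "k \<le> m" for k
    using grid_nonneg[OF assms(1) incr that] .
  have Y: "real_process N (Y i)" "eq_law N (Y i) M X" if "i \<in> {1..n}" for i
    using copies that by (auto simp: independent_copies_def)
  define g where "g v = (\<lambda>k\<in>{..<m}. v (\<tau> (Suc k)) - v (\<tau> k))" for v :: "real \<Rightarrow> real"
  \<comment> \<open>The time set \<open>T\<close> stays general: independence uses \<open>g\<close>
    on full paths over \<open>{0..}\<close>, equality in law uses it on the finite set
    \<open>?J\<close>.\<close>
  have g: "g \<in> measurable (Pi\<^sub>M T (\<lambda>_. borel)) (Pi\<^sub>M {..<m} (\<lambda>_. borel))" if "?J \<subseteq> T" for T
    unfolding g_def using that
    by (intro measurable_restrict borel_measurable_diff measurable_component_singleton) auto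
  have g_restrict: "g (\<lambda>t\<in>T. v t) = (\<lambda>k\<in>{..<m}. v (\<tau> (Suc k)) - v (\<tau> k))" if "?J \<subseteq> T" for T v
  proof -
    have "\<tau> k \<in> T" if "k \<le> m" for k using \<open>?J \<subseteq> T\<close> that by auto
    then show ?thesis by (auto simp: g_def fun_eq_iff)
  qed
  have J: "?J \<subseteq> {0..}" using nonneg by auto
  have "N.indep_vars (\<lambda>_. Pi\<^sub>M {0..} (\<lambda>_. borel)) (\<lambda>i \<omega>. \<lambda>t\<in>{0..}. Y i t \<omega>) {1..n}"
    using copies by (simp add: independent_copies_def)
  then have "N.indep_vars (\<lambda>_. Pi\<^sub>M {..<m} (\<lambda>_. borel)) (\<lambda>i \<omega>. g (\<lambda>t\<in>{0..}. Y i t \<omega>)) {1..n}"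
    by (rule N.indep_vars_compose2) (rule g[OF J])
  then have "distr N (Pi\<^sub>M {1..n} (\<lambda>_. Pi\<^sub>M {..<m} (\<lambda>_. borel)))
      (\<lambda>\<omega>. \<lambda>i\<in>{1..n}. \<lambda>k\<in>{..<m}. Y i (\<tau> (Suc k)) \<omega> - Y i (\<tau> k) \<omega>) =
    Pi\<^sub>M {1..n} (\<lambda>i. distr N (Pi\<^sub>M {..<m} (\<lambda>_. borel)) (\<lambda>\<omega>. \<lambda>k\<in>{..<m}. Y i (\<tau> (Suc k)) \<omega> - Y i (\<tau> k) \<omega>))"
    unfolding g_restrict[OF J]
    using \<open>n > 0\<close> by (intro N.distr_indep_vars) auto
  also have "\<dots> = Pi\<^sub>M {1..n} (\<lambda>_. Pi\<^sub>M {..<m} (\<lambda>k. distr M borel (X (\<tau> (Suc k) - \<tau> k))))"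
  proof (intro PiM_cong refl)
    fix i assume i: "i \<in> {1..n}"
    show "distr N (Pi\<^sub>M {..<m} (\<lambda>_. borel)) (\<lambda>\<omega>. \<lambda>k\<in>{..<m}. Y i (\<tau> (Suc k)) \<omega> - Y i (\<tau> k) \<omega>) =
        Pi\<^sub>M {..<m} (\<lambda>k. distr M borel (X (\<tau> (Suc k) - \<tau> k)))"
      using eq_law_functional[OF Y(2)[OF i] Y(1)[OF i] real_process_X _ J g[OF order_refl]]
        distr_increments[OF assms(1) incr \<open>m > 0\<close>]
      by (simp add: g_restrict[OF order_refl])
  qed
  finally show ?thesis .
qed

section \<open>From grids to finite-dimensional distributions\<close>

text \<open>The grid lists the points of \<open>J\<close> together with 0 and 1 in increasing order.
  Starting at 0 lets values at grid points be recovered from increments, up to the value at time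
  0.\<close>

lemma finite_set_grid:
  fixes J :: "real set"
  assumes "finite J" "J \<subseteq> {0..}"
  obtains \<tau> :: "nat \<Rightarrow> real" and m where "\<tau> 0 = 0" "\<And>i. i < m \<Longrightarrow> \<tau> i < \<tau> (Suc i)" "m > 0"
    "J \<subseteq> \<tau> ` {..m}"
proof -
  \<comment> \<open>The point \<open>1\<close> only ensures \<open>m > 0\<close> when \<open>J \<subseteq> {0}\<close>.\<close>
  let ?S = "insert 0 (insert 1 J)"
  define xs where "xs = sorted_list_of_set ?S"
  have xs: "set xs = ?S" "sorted xs" "distinct xs" "length xs = card ?S"
    using assms finite_insert[of _ J] unfolding xs_def
    by (simp_all del: sorted_list_of_set_insert_remove card_insert_disjoint)
  have sorted: "xs ! i < xs ! j" if "i < j" "j < length xs" for i j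
    using sorted_nth_mono[OF xs(2), of i j] nth_eq_iff_index_eq[OF xs(3), of i j] that by force
  have "card {0::real, 1} \<le> card ?S"
    using assms by (intro card_mono) auto
  then have len: "length xs \<ge> 2" using xs by simp
  have "xs ! 0 = 0"
  proof -
    have "xs ! 0 \<ge> 0" using xs(1) len assms(2) nth_mem[of 0 xs] by (cases "xs = []") auto
    moreover obtain k where k: "k < length xs" "xs ! k = 0"
      using xs(1) by (metis in_set_conv_nth insertI1)
    moreover have "xs ! 0 \<le> xs ! k"
      using k sorted[of 0 k] by (cases "k = 0") auto
    ultimately show ?thesis by simp
  qed
  moreover have "xs ! i < xs ! Suc i" if "i < length xs - 1" for i
    using sorted[of i "Suc i"] that by simp
  moreover have "J \<subseteq> (!) xs ` {..length xs - 1}"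
  proof
    fix t assume "t \<in> J"
    then obtain k where "k < length xs" "xs ! k = t"
      using xs(1) by (metis in_set_conv_nth insertCI)
    then show "t \<in> (!) xs ` {..length xs - 1}" by (auto intro!: image_eqI[of _ _ k])
  qed
  ultimately show ?thesis
    using that[of "(!) xs" "length xs - 1"] len by simp
qed

theorem proposition1p1:
  fixes M :: "'a measure" and X :: "real \<Rightarrow> 'a \<Rightarrow> real"
  assumes "levy_process M X"
  shows "IDT_process TYPE('b) M X"
proof -
  interpret levy_process M X by fact
  have "eq_law M (\<lambda>t. X (real n * t)) N (\<lambda>t \<omega>. \<Sum>i=1..n. Y i t \<omega>)"
    if n: "n \<ge> 1" and copies: "independent_copies M X n N Y" for n and N :: "'b measure" and Y
    unfolding eq_law_def
  proof (intro allI impI)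
    fix J :: "real set" assume "finite J \<and> J \<subseteq> {0..}"
    then have J: "finite J" "J \<subseteq> {0..}" by auto
    have "n > 0" using n by simp
    have Y: "real_process N (Y i)" "eq_law N (Y i) M X" if "i \<in> {1..n}" for i
      using copies that by (auto simp: independent_copies_def)
    \<comment> \<open>The first copy exists because \<open>n \<ge> 1\<close>, and it carries the
      fact that \<open>N\<close> is a probability space.\<close>
    have "prob_space N" using Y(1)[of 1] n by (simp add: real_process_def)
    obtain \<tau> :: "nat \<Rightarrow> real" and m where \<tau>: "\<tau> 0 = 0" "\<And>i. i < m \<Longrightarrow> \<tau> i < \<tau> (Suc i)" "m > 0"
      and J_grid: "J \<subseteq> \<tau> ` {..m}"
      using finite_set_grid[OF J] by metis
    have "\<forall>t\<in>J. \<exists>k. k \<le> m \<and> \<tau> k = t" using J_grid by auto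
    from bchoice[OF this] obtain p where p: "p t \<le> m" "\<tau> (p t) = t" if "t \<in> J" for t
      by blast
    let ?\<sigma> = "refined_grid n \<tau>"
    let ?P = "Pi\<^sub>M {1..n} (\<lambda>_. Pi\<^sub>M {..<m} (\<lambda>_. borel)) :: (nat \<Rightarrow> nat \<Rightarrow> real) measure"
    let ?Q = "Pi\<^sub>M J (\<lambda>_. borel) :: (real \<Rightarrow> real) measure"
    let ?V = "\<lambda>\<omega>. \<lambda>i\<in>{1..n}. \<lambda>k\<in>{..<m}. X (?\<sigma> (Suc (k * n + (i - 1)))) \<omega> - X (?\<sigma> (k * n + (i - 1))) \<omega>"
    let ?W = "\<lambda>\<omega>. \<lambda>i\<in>{1..n}. \<lambda>k\<in>{..<m}. Y i (\<tau> (Suc k)) \<omega> - Y i (\<tau> k) \<omega>"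
    \<comment> \<open>One map \<open>F\<close> serves both sides: it adds, over all rows, the
      increments of the first \<open>p t\<close> blocks, where \<open>p t\<close> is a grid index of
      \<open>t\<close>. Equality of the laws of \<open>?V\<close> and \<open>?W\<close> then carries
      over to their images under \<open>F\<close>.\<close>
    define F where "F v = (\<lambda>t\<in>J. \<Sum>i=1..n. \<Sum>k<p t. v i k)" for v :: "nat \<Rightarrow> nat \<Rightarrow> real"
    have same_law: "distr M ?P ?V = distr N ?P ?W"
      by (rule trans[OF distr_nested_increments distr_copies_increments[symmetric]])
        (use \<tau> \<open>n > 0\<close> copies \<open>prob_space N\<close> in simp_all)
    have F: "F \<in> measurable ?P ?Q"
      unfolding F_def
    proof (intro measurable_restrict borel_measurable_sum)
      fix t i k assume "t \<in> J" "i \<in> {1..n}" "k \<in> {..<p t}"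
      then have "i \<in> {1..n}" "k \<in> {..<m}" using p(1)[of t] by auto
      then show "(\<lambda>v. v i k) \<in> borel_measurable ?P"
        by (intro measurable_compose[where f = "\<lambda>v. v i" and g = "\<lambda>w. w k"
            and N = "Pi\<^sub>M {..<m} (\<lambda>_. borel)"] measurable_component_singleton)
    qed
    have \<tau>_nonneg: "\<tau> k \<ge> 0" if "k \<le> m" for k
      using grid_nonneg[of \<tau> m k] \<tau> that by simp
    have \<sigma>_nonneg: "?\<sigma> l \<ge> 0" if "l \<le> m * n" for l
      by (rule refined_grid_nonneg[OF _ _ \<open>n > 0\<close> that]) (use \<tau> in simp_all)
    have index_le: "Suc (k * n + (i - 1)) \<le> m * n" if "k < m" "i \<in> {1..n}" for k i
      using that by (intro Suc_leI mult_add_less_mult) auto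
    have V: "?V \<in> measurable M ?P"
      by (intro measurable_restrict borel_measurable_diff measurable_X \<sigma>_nonneg)
        (simp_all only: lessThan_iff index_le Suc_leD[OF index_le])
    have W: "?W \<in> measurable N ?P"
      using Y(1) \<tau>_nonneg
      by (intro measurable_restrict borel_measurable_diff) (auto simp: real_process_def)
    \<comment> \<open>After swapping the sums, the \<open>n\<close> pieces of block \<open>k\<close>
      have consecutive indices from \<open>k * n\<close> on. The blocks join into the first
      \<open>q * n\<close> fine increments, whose sum telescopes.\<close>
    have sum_V: "(\<Sum>i=1..n. \<Sum>k<q. ?V \<omega> i k) = X (real n * \<tau> q) \<omega> - X 0 \<omega>" if "q \<le> m" for q \<omega>
    proof -
      let ?f = "\<lambda>l. X (?\<sigma> (Suc l)) \<omega> - X (?\<sigma> l) \<omega>"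
      have "(\<Sum>i=1..n. \<Sum>k<q. ?V \<omega> i k) = (\<Sum>k<q. \<Sum>i=1..n. ?f (k * n + (i - 1)))"
        using that by (subst sum.swap) (auto intro!: sum.cong)
      also have "\<dots> = (\<Sum>k<q. sum ?f {k * n..<k * n + n})"
      proof (rule sum.cong[OF refl])
        show "(\<Sum>i=1..n. ?f (k * n + (i - 1))) = sum ?f {k * n..<k * n + n}" for k
          by (rule sum.reindex_bij_witness[of _ "\<lambda>l. Suc (l - k * n)" "\<lambda>i. k * n + (i - 1)"]) auto
      qed
      also have "\<dots> = sum ?f {..<q * n}" by (rule sum.nat_group)
      also have "\<dots> = X (?\<sigma> (q * n)) \<omega> - X (?\<sigma> 0) \<omega>"
        by (rule sum_lessThan_telescope)
      finally show ?thesis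
        using \<tau>(1) \<open>n > 0\<close> refined_grid_mult[OF \<open>n > 0\<close>, of \<tau> 0] by (simp add: refined_grid_mult)
    qed
    have sum_W: "(\<Sum>i=1..n. \<Sum>k<q. ?W \<omega> i k) = (\<Sum>i=1..n. Y i (\<tau> q) \<omega> - Y i 0 \<omega>)" if "q \<le> m" for q \<omega>
    proof (intro sum.cong refl)
      fix i assume "i \<in> {1..n}"
      then have "(\<Sum>k<q. ?W \<omega> i k) = (\<Sum>k<q. Y i (\<tau> (Suc k)) \<omega> - Y i (\<tau> k) \<omega>)"
        using that by (intro sum.cong) auto
      then show "(\<Sum>k<q. ?W \<omega> i k) = Y i (\<tau> q) \<omega> - Y i 0 \<omega>"
        using \<tau>(1) sum_lessThan_telescope[of "\<lambda>k. Y i (\<tau> k) \<omega>" q] by simp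
    qed
    \<comment> \<open>The two vectors agree only almost surely, because \<open>F \<circ> ?V\<close>
      produces \<open>X (real n * t) - X 0\<close>.\<close>
    have "distr M ?Q (\<lambda>\<omega>. \<lambda>t\<in>J. X (real n * t) \<omega>) = distr M ?Q (F \<circ> ?V)"
    proof (rule distr_cong_AE[OF refl refl _ _ measurable_comp[OF V F]])
      show "AE \<omega> in M. (\<lambda>t\<in>J. X (real n * t) \<omega>) = (F \<circ> ?V) \<omega>"
        using start_zero
      proof eventually_elim
        case (elim \<omega>)
        show ?case
          unfolding F_def comp_def
        proof (intro restrict_ext)
          fix t assume t: "t \<in> J"
          show "X (real n * t) \<omega> = (\<Sum>i=1..n. \<Sum>k<p t. ?V \<omega> i k)"
            using sum_V[OF p(1)[OF t], of \<omega>] p(2)[OF t] elim by simp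
        qed
      qed
      show "(\<lambda>\<omega>. \<lambda>t\<in>J. X (real n * t) \<omega>) \<in> measurable M ?Q"
        using J(2) by (intro measurable_restrict measurable_X) auto
    qed
    also have "\<dots> = distr (distr M ?P ?V) ?Q F" by (rule distr_distr[OF F V, symmetric])
    also have "\<dots> = distr N ?Q (F \<circ> ?W)" unfolding same_law by (rule distr_distr[OF F W])
    also have "\<dots> = distr N ?Q (\<lambda>\<omega>. \<lambda>t\<in>J. \<Sum>i=1..n. Y i t \<omega>)"
    proof (rule distr_cong_AE[OF refl refl _ measurable_comp[OF W F]])
      \<comment> \<open>There are finitely many copies, so one null set covers all their starting
        values.\<close>
      have "AE \<omega> in N. \<forall>i\<in>{1..n}. Y i 0 \<omega> = 0"
        using copy_start_zero Y by (intro AE_finite_allI) auto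
      then show "AE \<omega> in N. (F \<circ> ?W) \<omega> = (\<lambda>t\<in>J. \<Sum>i=1..n. Y i t \<omega>)"
      proof eventually_elim
        case (elim \<omega>)
        show ?case
          unfolding F_def comp_def
        proof (intro restrict_ext)
          fix t assume t: "t \<in> J"
          show "(\<Sum>i=1..n. \<Sum>k<p t. ?W \<omega> i k) = (\<Sum>i=1..n. Y i t \<omega>)"
            using sum_W[OF p(1)[OF t], of \<omega>] p(2)[OF t] elim by simp
        qed
      qed
      show "(\<lambda>\<omega>. \<lambda>t\<in>J. \<Sum>i=1..n. Y i t \<omega>) \<in> measurable N ?Q"
        using J(2) Y(1)
        by (intro measurable_restrict borel_measurable_sum) (auto simp: real_process_def)
    qed
    finally show "distr M ?Q (\<lambda>\<omega>. \<lambda>t\<in>J. X (real n * t) \<omega>) = distr N ?Q (\<lambda>\<omega>. \<lambda>t\<in>J. \<Sum>i=1..n. Y i t \<omega>)" .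
  qed
  then show ?thesis
    unfolding IDT_process_def using real_process_X by blast
qed

end
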